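(* Let $A$ be a commutative ring with unit containing $\mathbb{Q}$, and let $n\ge1$. For $M,N\in M_n(A)$, $$\det(I-MX)\star\det(I-NX)=\det(I-(M\otimes N)X)$$ in $1+XA[[X]]$, where $\star$ is the eñe product.
   Context: $M\otimes N\in M_{n^2}(A)$ is the tensor (Kronecker) product, defined by $(M\otimes N)(x\otimes y)=(Mx)\otimes(Ny)$; $I$ denotes the identity matrix of the appropriate size. Eñe product: for $k\ge1$, let $Q_k\in\mathbb{Z}[X_1,\dots,X_k,Y_1,\dots,Y_k]$ be the unique polynomial such that in $\mathbb{Z}[x_1,\dots,x_k,y_1,\dots,y_k]$ the $k$-th elementary symmetric polynomial of the $k^2$ products $x_iy_j$ equals $Q_k(e_1(x),\dots,e_k(x),e_1(y),\dots,e_k(y))$, where $e_r$ are the elementary symmetric polynomials. For $f=1+\sum_{k\ge1}a_kX^k$ and $g=1+\sum_{k\ge1}b_kX^k$ in $1+XA[[X]]$, $f\star g=1+\sum_{k\ge1}c_kX^k$ with $c_k=(-1)^kQ_k(a_1,\dots,a_k,b_1,\dots,b_k)$. *)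

theory Defs
  imports
    "HOL-Library.Poly_Mapping"
    "HOL-Computational_Algebra.Formal_Power_Series"
    "Jordan_Normal_Form.Determinant"
begin

no_notation fps_nth (infixl "$" 75)

section \<open>Integer polynomials in several variables\<close>

text \<open>Monomials are finitely supported exponent functions. The ring \<open>\<int>[X\<^sub>1,\<dots>,X\<^sub>k,Y\<^sub>1,\<dots>,Y\<^sub>k]\<close>
  consists of the polynomials over the variable type \<^typ>\<open>nat + nat\<close>
  that only involve \<open>Inl 1, \<dots>, Inl k\<close> (the \<open>X\<^sub>i\<close>) and \<open>Inr 1, \<dots>, Inr k\<close> (the \<open>Y\<^sub>i\<close>).\<close>

type_synonym 'v int_mpoly = "('v \<Rightarrow>\<^sub>0 nat) \<Rightarrow>\<^sub>0 int"

definition mvar :: "'v \<Rightarrow> 'v int_mpoly" where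
  "mvar v = Poly_Mapping.single (Poly_Mapping.single v 1) 1"

definition mvars :: "'v int_mpoly \<Rightarrow> 'v set" where
  "mvars p = (\<Union>m\<in>Poly_Mapping.keys p. Poly_Mapping.keys m)"

definition eval_mpoly :: "('v \<Rightarrow> 'a::comm_ring_1) \<Rightarrow> 'v int_mpoly \<Rightarrow> 'a" where
  "eval_mpoly f p = (\<Sum>m\<in>Poly_Mapping.keys p. of_int (Poly_Mapping.lookup p m) *
      (\<Prod>v\<in>Poly_Mapping.keys m. f v ^ Poly_Mapping.lookup m v))"

text \<open>The \<open>r\<close>-th elementary symmetric polynomial of a finite family \<open>(x\<^sub>i)\<^sub>i\<^sub>\<in>\<^sub>I\<close>.\<close>

definition elem_sym :: "nat \<Rightarrow> 'i set \<Rightarrow> ('i \<Rightarrow> 'a::comm_ring_1) \<Rightarrow> 'a" where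
  "elem_sym r I x = (\<Sum>S | S \<subseteq> I \<and> card S = r. \<Prod>i\<in>S. x i)"

section \<open>The ene product\<close>

text \<open>In the defining equation of \<open>Q\<^sub>k\<close>, which lives in \<open>\<int>[x\<^sub>1,\<dots>,x\<^sub>k,y\<^sub>1,\<dots>,y\<^sub>k]\<close>, the variables
  \<open>x\<^sub>i\<close> and \<open>y\<^sub>i\<close> are again \<open>Inl i\<close> and \<open>Inr i\<close>.\<close>

definition ene_poly :: "nat \<Rightarrow> (nat + nat) int_mpoly" where
  "ene_poly k = (THE Q.
     mvars Q \<subseteq> Inl ` {1..k} \<union> Inr ` {1..k} \<and>
     eval_mpoly (case_sum (\<lambda>r. elem_sym r {1..k} (\<lambda>i. mvar (Inl i)))
                          (\<lambda>r. elem_sym r {1..k} (\<lambda>j. mvar (Inr j)))) Q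
       = elem_sym k ({1..k} \<times> {1..k})
           (\<lambda>(i, j). mvar (Inl i) * mvar (Inr j) :: (nat + nat) int_mpoly))"

text \<open>Meaningful only for series with constant coefficient \<open>1\<close>.\<close>

definition ene :: "'a::comm_ring_1 fps \<Rightarrow> 'a fps \<Rightarrow> 'a fps" (infixl "\<star>" 70) where
  "f \<star> g = Abs_fps (\<lambda>k. if k = 0 then 1
     else (-1) ^ k * eval_mpoly (case_sum (fps_nth f) (fps_nth g)) (ene_poly k))"

section \<open>Tensor products of vectors and matrices\<close>

text \<open>The basis vector \<open>e\<^sub>i \<otimes> e\<^sub>j\<close> of \<open>A\<^sup>n \<otimes> A\<^sup>n\<close> is identified with the unit vector of index
  \<open>i * n + j\<close> in \<open>A\<^bsup>n * n\<^esup>\<close>.\<close>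

definition tensor_vec :: "'a::comm_ring_1 vec \<Rightarrow> 'a vec \<Rightarrow> 'a vec" where
  "tensor_vec u v = vec (dim_vec u * dim_vec v)
     (\<lambda>i. u $ (i div dim_vec v) * v $ (i mod dim_vec v))"

definition tensor_mat :: "'a::comm_ring_1 mat \<Rightarrow> 'a mat \<Rightarrow> 'a mat" where
  "tensor_mat M N = mat (dim_row M * dim_row N) (dim_col M * dim_col N)
     (\<lambda>(i, j). M $$ (i div dim_row N, j div dim_col N) * N $$ (i mod dim_row N, j mod dim_col N))"

lemma sum_div_mod:
  fixes n m :: nat
  shows "(\<Sum>j<n * m. f (j div m) (j mod m)) = (\<Sum>a<n. \<Sum>b<m. f a b)"
proof -
  have "(\<Sum>j<n * m. f (j div m) (j mod m)) = (\<Sum>(a, b)\<in>{..<n} \<times> {..<m}. f a b)"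
  proof (rule sum.reindex_bij_witness[where i = "\<lambda>(a, b). a * m + b" and j = "\<lambda>j. (j div m, j mod m)"])
    fix j assume j: "j \<in> {..<n * m}"
    then have "m > 0" by (cases m) auto
    with j show "(j div m, j mod m) \<in> {..<n} \<times> {..<m}"
      by (auto simp: less_mult_imp_div_less)
  next
    fix p assume p: "p \<in> {..<n} \<times> {..<m}"
    obtain a b where ab: "p = (a, b)" "a < n" "b < m" using p by auto
    have "a * m + b < Suc a * m" using ab by simp
    also have "\<dots> \<le> n * m" using ab by (intro mult_le_mono1) simp
    finally show "(case p of (a, b) \<Rightarrow> a * m + b) \<in> {..<n * m}" using ab by simp
  qed auto
  then show ?thesis by (simp add: sum.cartesian_product)
qed

lemma tensor_mat_carrier [simp, intro]:
  "M \<in> carrier_mat n n \<Longrightarrow> N \<in> carrier_mat n n \<Longrightarrow> tensor_mat M N \<in> carrier_mat (n * n) (n * n)"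
  by (auto simp: tensor_mat_def)

lemma tensor_mat_mult_tensor_vec:
  assumes "M \<in> carrier_mat n n" "N \<in> carrier_mat n n" "x \<in> carrier_vec n" "y \<in> carrier_vec n"
  shows "tensor_mat M N *\<^sub>v tensor_vec x y = tensor_vec (M *\<^sub>v x) (N *\<^sub>v y)"
proof (rule eq_vecI)
  fix i assume "i < dim_vec (tensor_vec (M *\<^sub>v x) (N *\<^sub>v y))"
  then have i: "i < n * n" using assms by (simp add: tensor_vec_def)
  then have n: "n > 0" by (cases n) auto
  have d: "i div n < n" "i mod n < n" using i n by (auto simp: less_mult_imp_div_less)
  let ?g = "\<lambda>a b. M $$ (i div n, a) * N $$ (i mod n, b) * (x $ a * y $ b)"
  have "(tensor_mat M N *\<^sub>v tensor_vec x y) $ i = (\<Sum>j<n * n. ?g (j div n) (j mod n))"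
    using assms i by (simp add: tensor_mat_def tensor_vec_def scalar_prod_def lessThan_atLeast0)
  also have "\<dots> = (\<Sum>a<n. \<Sum>b<n. ?g a b)"
    by (rule sum_div_mod)
  also have "\<dots> = (\<Sum>a<n. M $$ (i div n, a) * x $ a) * (\<Sum>b<n. N $$ (i mod n, b) * y $ b)"
    by (simp add: sum_product mult_ac)
  also have "\<dots> = tensor_vec (M *\<^sub>v x) (N *\<^sub>v y) $ i"
    using assms i d by (simp add: tensor_vec_def scalar_prod_def lessThan_atLeast0)
  finally show "(tensor_mat M N *\<^sub>v tensor_vec x y) $ i = tensor_vec (M *\<^sub>v x) (N *\<^sub>v y) $ i" .
qed (use assms in \<open>simp add: tensor_vec_def tensor_mat_def\<close>)

lemma tensor_vec_unit:
  assumes "j < n * n"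
  shows "tensor_vec (unit_vec n (j div n)) (unit_vec n (j mod n)) = (unit_vec (n * n) j :: 'a::comm_ring_1 vec)"
proof (rule eq_vecI)
  fix i assume "i < dim_vec (unit_vec (n * n) j :: 'a vec)"
  then have i: "i < n * n" by simp
  then have n: "n > 0" by (cases n) auto
  have "i div n < n" "i mod n < n" "j div n < n" "j mod n < n"
    using i assms n by (auto simp: less_mult_imp_div_less)
  moreover have "i div n = j div n \<and> i mod n = j mod n \<longleftrightarrow> i = j"
    by (metis div_mult_mod_eq)
  ultimately show "tensor_vec (unit_vec n (j div n)) (unit_vec n (j mod n)) $ i
      = (unit_vec (n * n) j :: 'a vec) $ i"
    using i assms by (auto simp: tensor_vec_def unit_vec_def)
qed (simp add: tensor_vec_def)

lemma tensor_mat_unique: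
  assumes M: "M \<in> carrier_mat n n" and N: "N \<in> carrier_mat n n"
    and P: "P \<in> carrier_mat (n * n) (n * n)"
    and eq: "\<And>x y. x \<in> carrier_vec n \<Longrightarrow> y \<in> carrier_vec n \<Longrightarrow>
               P *\<^sub>v tensor_vec x y = tensor_vec (M *\<^sub>v x) (N *\<^sub>v y)"
  shows "P = tensor_mat M N"
proof (rule eq_matI)
  have T: "tensor_mat M N \<in> carrier_mat (n * n) (n * n)" using M N by simp
  fix i j assume "i < dim_row (tensor_mat M N)" "j < dim_col (tensor_mat M N)"
  then have ij: "i < n * n" "j < n * n" using T by auto
  have "P *\<^sub>v unit_vec (n * n) j = tensor_mat M N *\<^sub>v unit_vec (n * n) j"
    using eq[of "unit_vec n (j div n)" "unit_vec n (j mod n)"]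
      tensor_mat_mult_tensor_vec[OF M N, of "unit_vec n (j div n)" "unit_vec n (j mod n)"]
    by (simp add: tensor_vec_unit[OF ij(2)])
  then have "(P *\<^sub>v unit_vec (n * n) j) $ i = (tensor_mat M N *\<^sub>v unit_vec (n * n) j) $ i"
    by simp
  then show "P $$ (i, j) = tensor_mat M N $$ (i, j)"
    using ij P T by (simp add: scalar_prod_right_unit)
qed (use M N P in \<open>auto simp: tensor_mat_def\<close>)

section \<open>The determinant of \<open>I - MX\<close> as a power series\<close>

lemma det_one_minus_nth_0:
  fixes M :: "'a::comm_ring_1 mat"
  assumes "M \<in> carrier_mat n n"
  shows "fps_nth (det (1\<^sub>m n - fps_X \<cdot>\<^sub>m map_mat fps_const M)) 0 = 1"
proof -
  interpret h: comm_ring_hom "\<lambda>f :: 'a fps. fps_nth f 0"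
    by unfold_locales simp_all
  have "map_mat (\<lambda>f. fps_nth f 0) (1\<^sub>m n - fps_X \<cdot>\<^sub>m map_mat fps_const M) = 1\<^sub>m n"
    using assms by (intro eq_matI) auto
  then show ?thesis
    using assms by (simp add: flip: h.hom_det)
qed

end

theory Submission
  imports Defs "HOL-Computational_Algebra.Fundamental_Theorem_Algebra"
begin

text \<open>By Newton's identities, which hold for the coefficients of \<open>f\<^sub>M = det (I - XM)\<close> over every
  commutative ring, \<open>f\<^sub>M\<close> modulo \<open>X\<^bsup>k+1\<^esup>\<close> determines \<open>tr M, \<dots>, tr M\<^sup>k\<close>; conversely these
  traces determine \<open>f\<^sub>M\<close> modulo \<open>X\<^bsup>k+1\<^esup>\<close> if the ring is torsion-free. As the traces of powers are
  multiplicative for tensor products, \<open>f\<close> of \<open>M \<otimes> N\<close> modulo \<open>X\<^bsup>k+1\<^esup>\<close> only depends on \<open>f\<^sub>M\<close> and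
  \<open>f\<^sub>N\<close> modulo \<open>X\<^bsup>k+1\<^esup>\<close>, even when the sizes of the matrices are allowed to vary.

  So \<open>M\<close> and \<open>N\<close> may be replaced by \<open>k \<times> k\<close> companion matrices of the truncated series. Over
  \<open>\<int>[X\<^sub>1,\<dots>,X\<^sub>k,Y\<^sub>1,\<dots>,Y\<^sub>k]\<close> the same construction with generic companion matrices yields an
  integer polynomial, and comparing them with diagonal matrices shows that it has the defining
  property of \<open>Q\<^sub>k\<close>. Uniqueness of \<open>Q\<^sub>k\<close> holds because by the fundamental theorem of algebra
  elementary symmetric polynomials take arbitrary values at complex points.\<close>

section \<open>Newton's identities and tensor products\<close>

text \<open>The reversed characteristic polynomial of \<open>M\<close>, taken as a power series so
  that matrices of different sizes can be compared coefficient by coefficient.\<close>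

definition rev_char_fps :: "'a::comm_ring_1 mat \<Rightarrow> 'a fps" where
  "rev_char_fps M = det (1\<^sub>m (dim_row M) - fps_X \<cdot>\<^sub>m map_mat fps_const M)"

definition mat_trace :: "'a::comm_ring_1 mat \<Rightarrow> 'a" where
  "mat_trace M = (\<Sum>i<dim_row M. M $$ (i, i))"

lemma fps_deriv_prod:
  fixes f :: "'i \<Rightarrow> 'a::comm_ring_1 fps"
  assumes "finite A"
  shows "fps_deriv (\<Prod>i\<in>A. f i) = (\<Sum>i\<in>A. fps_deriv (f i) * (\<Prod>j\<in>A - {i}. f j))"
  using assms
proof (induction A)
  case (insert a A)
  have "(\<Prod>j\<in>insert a A - {i}. f j) = f a * (\<Prod>j\<in>A - {i}. f j)" if "i \<in> A" for i
  proof -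
    have "insert a A - {i} = insert a (A - {i})" using insert that by auto
    then show ?thesis using insert by simp
  qed
  moreover have "insert a A - {a} = A" using insert by auto
  ultimately show ?case
    using insert by (simp add: sum_distrib_left mult_ac cong: sum.cong)
qed simp

text \<open>Differentiating row \<open>i\<close> leaves its cofactors unchanged, so Laplace expansion applies.\<close>

lemma fps_deriv_det:
  fixes B :: "'a::comm_ring_1 fps mat"
  assumes B: "B \<in> carrier_mat n n"
  shows "fps_deriv (det B) = (\<Sum>i<n. \<Sum>j<n. fps_deriv (B $$ (i, j)) * cofactor B i j)"
proof -
  define R where "R i = mat n n (\<lambda>(a, b). if a = i then fps_deriv (B $$ (a, b)) else B $$ (a, b))" for i
  have R: "R i \<in> carrier_mat n n" for i by (simp add: R_def)
  have "mat_delete (R i) i j = mat_delete B i j" if "i < n" "j < n" for i j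
    using that B by (intro eq_matI) (auto simp: R_def mat_delete_def)
  then have "det (R i) = (\<Sum>j<n. fps_deriv (B $$ (i, j)) * cofactor B i j)" if "i < n" for i
    using that by (subst laplace_expansion_row[OF R that], intro sum.cong)
      (auto simp: R_def cofactor_def)
  moreover have "fps_deriv (det B) = (\<Sum>i<n. det (R i))"
  proof -
    have s: "fps_deriv (signof p * F) = signof p * fps_deriv F" for p and F :: "'a fps"
      by (simp add: sign_def)
    \<comment> \<open>Each term of the product rule, summed over all permutations, is the Leibniz
      expansion with row \<open>i\<close> differentiated.\<close>
    have "fps_deriv (det B) = (\<Sum>p | p permutes {0..<n}. \<Sum>i<n. signof p *
        (fps_deriv (B $$ (i, p i)) * (\<Prod>a\<in>{0..<n} - {i}. B $$ (a, p a))))"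
      by (simp add: det_def'[OF B] fps_deriv_sum s fps_deriv_prod sum_distrib_left lessThan_atLeast0)
    also have "\<dots> = (\<Sum>i<n. \<Sum>p | p permutes {0..<n}. signof p *
        (fps_deriv (B $$ (i, p i)) * (\<Prod>a\<in>{0..<n} - {i}. B $$ (a, p a))))"
      by (rule sum.swap)
    also have "\<dots> = (\<Sum>i<n. det (R i))"
    proof (intro sum.cong refl)
      fix i assume i: "i \<in> {..<n}"
      have "fps_deriv (B $$ (i, p i)) * (\<Prod>a\<in>{0..<n} - {i}. B $$ (a, p a))
          = (\<Prod>a = 0..<n. R i $$ (a, p a))" if p: "p permutes {0..<n}" for p
      proof -
        have lt: "p a < n" if "a < n" for a
          using permutes_in_image[OF p, of a] that by simp
        have "(\<Prod>a = 0..<n. R i $$ (a, p a))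
            = R i $$ (i, p i) * (\<Prod>a\<in>{0..<n} - {i}. R i $$ (a, p a))"
          using i by (intro prod.remove) auto
        also have "(\<Prod>a\<in>{0..<n} - {i}. R i $$ (a, p a)) = (\<Prod>a\<in>{0..<n} - {i}. B $$ (a, p a))"
          using lt by (intro prod.cong) (auto simp: R_def)
        finally show ?thesis using i lt by (simp add: R_def)
      qed
      then show "(\<Sum>p | p permutes {0..<n}. signof p *
          (fps_deriv (B $$ (i, p i)) * (\<Prod>a\<in>{0..<n} - {i}. B $$ (a, p a)))) = det (R i)"
        unfolding det_def'[OF R] by (intro sum.cong) auto
    qed
    finally show ?thesis .
  qed
  ultimately show ?thesis by simp
qed

text \<open>Comparing coefficients in \<open>adj B * B = det B * I\<close> for \<open>B = I - XM\<close> expresses \<open>adj B\<close>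
  through the powers of \<open>M\<close>; inserting this into \<open>(det B)' = - tr (M * adj B)\<close> gives the identity.\<close>

lemma newton_identity:
  fixes M :: "'a::comm_ring_1 mat"
  assumes M: "M \<in> carrier_mat n n"
  defines "f \<equiv> fps_nth (rev_char_fps M)"
  shows "of_nat (Suc k) * f (Suc k) = - (\<Sum>l\<le>k. f l * mat_trace (M ^\<^sub>m Suc (k - l)))"
proof -
  define B where "B = 1\<^sub>m n - fps_X \<cdot>\<^sub>m map_mat fps_const M"
  have B: "B \<in> carrier_mat n n" using M unfolding B_def by (intro minus_carrier_mat) auto
  have f: "f = fps_nth (det B)" using M by (simp add: f_def rev_char_fps_def B_def)
  have pow: "M ^\<^sub>m k \<in> carrier_mat n n" for k using M by simp
  \<comment> \<open>\<open>g k i j\<close> is the coefficient of \<open>X ^ k\<close> in entry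
    \<open>(i, j)\<close> of the adjugate; hence the transposed cofactor indices.\<close>
  define g where "g k i j = fps_nth (cofactor B j i) k" for k i j
  \<comment> \<open>This is entry \<open>(i, j)\<close> of \<open>adj B * B = det B * I\<close> with
    \<open>B = I - XM\<close> written out.\<close>
  have rec: "cofactor B j i - fps_X * (\<Sum>l<n. cofactor B l i * fps_const (M $$ (l, j)))
      = (if i = j then det B else 0)" if ij: "i < n" "j < n" for i j
  proof -
    have "(adj_mat B * B) $$ (i, j) = (\<Sum>l<n. cofactor B l i * B $$ (l, j))"
      using B ij by (simp add: adj_mat_def scalar_prod_def lessThan_atLeast0)
    also have "\<dots> = (\<Sum>l<n. (if l = j then cofactor B j i else 0)
        - fps_X * (cofactor B l i * fps_const (M $$ (l, j))))"
      using ij M by (intro sum.cong) (auto simp: B_def algebra_simps)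
    also have "\<dots> = cofactor B j i - fps_X * (\<Sum>l<n. cofactor B l i * fps_const (M $$ (l, j)))"
      using ij by (simp add: sum_subtractf sum_distrib_left)
    finally show ?thesis using ij adj_mat(3)[OF B] by (cases "i = j") simp_all
  qed
  have g0: "g 0 i j = (if i = j then f 0 else 0)" if "i < n" "j < n" for i j
    using arg_cong[OF rec[OF that], of "\<lambda>F. fps_nth F 0"] by (simp add: g_def f)
  have gS: "g (Suc k) i j = (if i = j then f (Suc k) else 0) + (\<Sum>l<n. g k i l * M $$ (l, j))"
    if "i < n" "j < n" for k i j
    using arg_cong[OF rec[OF that], of "\<lambda>F. fps_nth F (Suc k)"]
    by (simp add: g_def f fps_sum_nth algebra_simps split: if_splits)
  have g: "g k i j = (\<Sum>l\<le>k. f l * (M ^\<^sub>m (k - l)) $$ (i, j))" if "i < n" "j < n" for k i j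
    using that
  proof (induction k arbitrary: j)
    case 0
    then show ?case using M by (simp add: g0)
  next
    case (Suc k)
    have "(\<Sum>m<n. g k i m * M $$ (m, j))
        = (\<Sum>m<n. \<Sum>l\<le>k. f l * ((M ^\<^sub>m (k - l)) $$ (i, m) * M $$ (m, j)))"
      using Suc by (intro sum.cong) (simp_all add: sum_distrib_right mult.assoc)
    also have "\<dots> = (\<Sum>l\<le>k. f l * (\<Sum>m<n. (M ^\<^sub>m (k - l)) $$ (i, m) * M $$ (m, j)))"
      by (subst sum.swap) (simp add: sum_distrib_left)
    also have "\<dots> = (\<Sum>l\<le>k. f l * (M ^\<^sub>m (Suc k - l)) $$ (i, j))"
    proof (intro sum.cong refl)
      fix l assume "l \<in> {..k}"
      then have "M ^\<^sub>m (Suc k - l) = M ^\<^sub>m (k - l) * M" by (simp add: Suc_diff_le)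
      then show "f l * (\<Sum>m<n. (M ^\<^sub>m (k - l)) $$ (i, m) * M $$ (m, j)) = f l * (M ^\<^sub>m (Suc k - l)) $$ (i, j)"
        using Suc.prems M pow[of "k - l"] by (simp add: scalar_prod_def lessThan_atLeast0)
    qed
    finally show ?case using Suc.prems M by (simp add: gS)
  qed
  have "of_nat (Suc k) * f (Suc k) = fps_nth (fps_deriv (det B)) k"
    by (simp add: f)
  also have "\<dots> = (\<Sum>i<n. \<Sum>j<n. - (M $$ (i, j)) * g k j i)"
  proof -
    have d: "fps_deriv (B $$ (i, j)) = fps_const (- (M $$ (i, j)))" if "i < n" "j < n" for i j
      using that M by (simp add: B_def fps_const_neg flip: fps_const_neg)
    show ?thesis
      by (simp add: fps_deriv_det[OF B] fps_sum_nth g_def d)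
  qed
  also have "\<dots> = - (\<Sum>i<n. \<Sum>j<n. \<Sum>l\<le>k. f l * ((M ^\<^sub>m (k - l)) $$ (j, i) * M $$ (i, j)))"
    by (simp add: g sum_negf sum_distrib_left mult_ac)
  \<comment> \<open>With \<open>l\<close> outermost, the inner double sum is the trace of a
    product.\<close>
  also have "(\<Sum>i<n. \<Sum>j<n. \<Sum>l\<le>k. f l * ((M ^\<^sub>m (k - l)) $$ (j, i) * M $$ (i, j)))
      = (\<Sum>l\<le>k. \<Sum>j<n. \<Sum>i<n. f l * ((M ^\<^sub>m (k - l)) $$ (j, i) * M $$ (i, j)))"
    by (subst sum.swap, subst (2) sum.swap, subst sum.swap) (rule refl)
  also have "\<dots> = (\<Sum>l\<le>k. f l * mat_trace (M ^\<^sub>m Suc (k - l)))"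
  proof (intro sum.cong refl)
    fix l
    have "mat_trace (M ^\<^sub>m Suc (k - l)) = (\<Sum>j<n. \<Sum>i<n. (M ^\<^sub>m (k - l)) $$ (j, i) * M $$ (i, j))"
      using M pow[of "k - l"] by (simp add: mat_trace_def scalar_prod_def lessThan_atLeast0)
    then show "(\<Sum>j<n. \<Sum>i<n. f l * ((M ^\<^sub>m (k - l)) $$ (j, i) * M $$ (i, j)))
        = f l * mat_trace (M ^\<^sub>m Suc (k - l))"
      by (simp add: sum_distrib_left)
  qed
  finally show ?thesis .
qed

section \<open>Coefficients and power traces determine each other\<close>

lemma rev_char_fps_nth_0:
  assumes "M \<in> carrier_mat n n"
  shows "fps_nth (rev_char_fps M) 0 = 1"
  using det_one_minus_nth_0[OF assms] assms by (simp add: rev_char_fps_def)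

text \<open>As the constant coefficient is 1, the summand \<open>l = 0\<close> of Newton's identity
  is a bare power trace, so the traces are found recursively without division. The trace of power
  \<open>j + 1\<close> involves coefficients up to degree \<open>j + 1\<close>, hence
  \<open>j < k\<close>.\<close>

lemma mat_trace_pow_cong:
  fixes M M' :: "'a::comm_ring_1 mat"
  assumes M: "M \<in> carrier_mat n n" and M': "M' \<in> carrier_mat m m"
    and eq: "\<And>j. j \<le> k \<Longrightarrow> fps_nth (rev_char_fps M) j = fps_nth (rev_char_fps M') j"
  shows "j < k \<Longrightarrow> mat_trace (M ^\<^sub>m Suc j) = mat_trace (M' ^\<^sub>m Suc j)"
proof (induction j rule: less_induct)
  case (less j)
  let ?f = "fps_nth (rev_char_fps M)"
  have split: "(\<Sum>l\<le>j. h l * mat_trace (A ^\<^sub>m Suc (j - l))) = h 0 * mat_trace (A ^\<^sub>m Suc j)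
      + (\<Sum>l\<in>{1..j}. h l * mat_trace (A ^\<^sub>m Suc (j - l)))" for h and A :: "'a mat"
    by (subst sum.remove[of _ 0]) (auto intro!: arg_cong2[of _ _ _ _ "(+)"] sum.cong)
  have rest: "(\<Sum>l\<in>{1..j}. ?f l * mat_trace (M ^\<^sub>m Suc (j - l)))
      = (\<Sum>l\<in>{1..j}. fps_nth (rev_char_fps M') l * mat_trace (M' ^\<^sub>m Suc (j - l)))"
    using less eq by (intro sum.cong) auto
  show ?case
    using newton_identity[OF M, of j] newton_identity[OF M', of j] eq[of "Suc j"] less.prems rest
    unfolding split by (simp add: rev_char_fps_nth_0[OF M] rev_char_fps_nth_0[OF M'])
qed

text \<open>Newton's identity expresses \<open>i + 1\<close> times the coefficient of
  \<open>X ^ (i + 1)\<close> through lower coefficients and traces; torsion-freeness cancels the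
  factor.\<close>

lemma rev_char_fps_nth_cong:
  fixes M M' :: "'a::comm_ring_1 mat"
  assumes torsion_free: "\<And>i (a :: 'a). of_nat (Suc i) * a = 0 \<Longrightarrow> a = 0"
    and M: "M \<in> carrier_mat n n" and M': "M' \<in> carrier_mat m m"
    and eq: "\<And>j. j < k \<Longrightarrow> mat_trace (M ^\<^sub>m Suc j) = mat_trace (M' ^\<^sub>m Suc j)"
  shows "j \<le> k \<Longrightarrow> fps_nth (rev_char_fps M) j = fps_nth (rev_char_fps M') j"
proof (induction j rule: less_induct)
  case (less j)
  show ?case
  proof (cases j)
    case 0
    then show ?thesis by (simp add: rev_char_fps_nth_0[OF M] rev_char_fps_nth_0[OF M'])
  next
    case (Suc i)
    have "of_nat (Suc i) * fps_nth (rev_char_fps M) (Suc i)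
        = of_nat (Suc i) * fps_nth (rev_char_fps M') (Suc i)"
      unfolding newton_identity[OF M] newton_identity[OF M']
      using less Suc eq by (intro arg_cong[of _ _ uminus] sum.cong) auto
    then have "of_nat (Suc i) * (fps_nth (rev_char_fps M) (Suc i) - fps_nth (rev_char_fps M') (Suc i)) = 0"
      by (simp only: right_diff_distrib diff_self)
    then show ?thesis using torsion_free Suc by fastforce
  qed
qed

section \<open>Powers and traces of Kronecker products\<close>

text \<open>Both sides act alike on pure tensors, and this action determines the matrix.\<close>

lemma tensor_mat_mult:
  assumes "M \<in> carrier_mat n n" "N \<in> carrier_mat n n" "M' \<in> carrier_mat n n" "N' \<in> carrier_mat n n"
  shows "tensor_mat M N * tensor_mat M' N' = tensor_mat (M * M') (N * N')"
proof (rule tensor_mat_unique[of _ n])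
  fix x y :: "'a vec" assume xy: "x \<in> carrier_vec n" "y \<in> carrier_vec n"
  have "tensor_vec x y \<in> carrier_vec (n * n)" using xy by (auto simp: tensor_vec_def)
  then have "tensor_mat M N * tensor_mat M' N' *\<^sub>v tensor_vec x y
      = tensor_mat M N *\<^sub>v (tensor_mat M' N' *\<^sub>v tensor_vec x y)"
    using assms by (intro assoc_mult_mat_vec[of _ "n * n" "n * n" _ "n * n"]) auto
  also have "\<dots> = tensor_vec (M * M' *\<^sub>v x) (N * N' *\<^sub>v y)"
    using assms xy by (simp add: tensor_mat_mult_tensor_vec[of _ n])
  finally show "tensor_mat M N * tensor_mat M' N' *\<^sub>v tensor_vec x y
      = tensor_vec (M * M' *\<^sub>v x) (N * N' *\<^sub>v y)" .
qed (use assms in \<open>auto intro!: mult_carrier_mat[of _ "n * n" "n * n"]\<close>)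

lemma tensor_mat_pow:
  assumes "M \<in> carrier_mat n n" "N \<in> carrier_mat n n"
  shows "tensor_mat M N ^\<^sub>m Suc k = tensor_mat (M ^\<^sub>m Suc k) (N ^\<^sub>m Suc k)"
proof (induction k)
  case 0
  then show ?case using assms tensor_mat_carrier[OF assms] by simp
next
  case (Suc k)
  have "tensor_mat M N ^\<^sub>m Suc (Suc k) = tensor_mat M N ^\<^sub>m Suc k * tensor_mat M N" by simp
  also have "\<dots> = tensor_mat (M ^\<^sub>m Suc k * M) (N ^\<^sub>m Suc k * N)"
    unfolding Suc.IH using assms by (intro tensor_mat_mult pow_carrier_mat)
  finally show ?case by simp
qed

lemma mat_trace_tensor_mat:
  assumes "M \<in> carrier_mat n n" "N \<in> carrier_mat n n"
  shows "mat_trace (tensor_mat M N) = mat_trace M * mat_trace N"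
proof -
  have "mat_trace (tensor_mat M N) = (\<Sum>i<n * n. M $$ (i div n, i div n) * N $$ (i mod n, i mod n))"
    using assms by (simp add: mat_trace_def tensor_mat_def)
  also have "\<dots> = (\<Sum>a<n. \<Sum>b<n. M $$ (a, a) * N $$ (b, b))"
    by (rule sum_div_mod)
  also have "\<dots> = mat_trace M * mat_trace N"
    using assms by (simp add: mat_trace_def sum_product)
  finally show ?thesis .
qed

text \<open>The comparison passes from coefficients to power traces, uses multiplicativity of the
  trace, and returns. Since \<open>m\<close> may differ from \<open>n\<close>, it allows a change of
  matrix size.\<close>

lemma rev_char_fps_tensor_mat_nth_cong:
  fixes M N M' N' :: "'a::comm_ring_1 mat"
  assumes torsion_free: "\<And>i (a :: 'a). of_nat (Suc i) * a = 0 \<Longrightarrow> a = 0"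
    and M: "M \<in> carrier_mat n n" and N: "N \<in> carrier_mat n n"
    and M': "M' \<in> carrier_mat m m" and N': "N' \<in> carrier_mat m m"
    and eqM: "\<And>j. j \<le> k \<Longrightarrow> fps_nth (rev_char_fps M) j = fps_nth (rev_char_fps M') j"
    and eqN: "\<And>j. j \<le> k \<Longrightarrow> fps_nth (rev_char_fps N) j = fps_nth (rev_char_fps N') j"
  shows "fps_nth (rev_char_fps (tensor_mat M N)) k = fps_nth (rev_char_fps (tensor_mat M' N')) k"
proof (rule rev_char_fps_nth_cong[OF torsion_free])
  fix j assume j: "j < k"
  have "mat_trace (tensor_mat M N ^\<^sub>m Suc j) = mat_trace (M ^\<^sub>m Suc j) * mat_trace (N ^\<^sub>m Suc j)"
    unfolding tensor_mat_pow[OF M N] using M N by (intro mat_trace_tensor_mat pow_carrier_mat)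
  moreover have "mat_trace (tensor_mat M' N' ^\<^sub>m Suc j) = mat_trace (M' ^\<^sub>m Suc j) * mat_trace (N' ^\<^sub>m Suc j)"
    unfolding tensor_mat_pow[OF M' N'] using M' N' by (intro mat_trace_tensor_mat pow_carrier_mat)
  ultimately show "mat_trace (tensor_mat M N ^\<^sub>m Suc j) = mat_trace (tensor_mat M' N' ^\<^sub>m Suc j)"
    using mat_trace_pow_cong[OF M M' eqM j] mat_trace_pow_cong[OF N N' eqN j] by simp
qed (use M N M' N' in auto)

section \<open>Companion and diagonal matrices\<close>

text \<open>The negated coefficients fill the first row, which makes \<open>det (I - XC)\<close>
  equal to \<open>1 + a 1 X + ... + a k X ^ k\<close>; the constant term 1 is built in.\<close>

definition companion_mat :: "nat \<Rightarrow> (nat \<Rightarrow> 'a::comm_ring_1) \<Rightarrow> 'a mat" where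
  "companion_mat k a = mat k k (\<lambda>(i, j). if i = 0 then - a (Suc j) else if i = Suc j then 1 else 0)"

lemma companion_mat_carrier [simp]: "companion_mat k a \<in> carrier_mat k k"
  by (simp add: companion_mat_def)

text \<open>Multiplication by \<open>L\<close>, the inverse of the bidiagonal matrix obtained for \<open>a = 0\<close>,
  makes \<open>I - XC\<close> upper triangular.\<close>

lemma rev_char_fps_companion_mat:
  fixes a :: "nat \<Rightarrow> 'a::comm_ring_1"
  assumes "k > 0"
  shows "rev_char_fps (companion_mat k a) = 1 + (\<Sum>m<k. fps_const (a (Suc m)) * fps_X ^ Suc m)"
proof -
  define B where "B = 1\<^sub>m k - fps_X \<cdot>\<^sub>m map_mat fps_const (companion_mat k a)"
  define L :: "'a fps mat" where "L = mat k k (\<lambda>(i, j). if j \<le> i then fps_X ^ (i - j) else 0)"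
  have B: "B \<in> carrier_mat k k"
    unfolding B_def by (intro minus_carrier_mat) auto
  have L: "L \<in> carrier_mat k k" by (simp add: L_def)
  have BL: "B * L \<in> carrier_mat k k" using B L by simp
  have B0: "B $$ (0, m) = (if m = 0 then 1 else 0) + fps_const (a (Suc m)) * fps_X" if "m < k" for m
    using that assms by (simp add: B_def companion_mat_def mult.commute flip: fps_const_neg)
  have BS: "B $$ (Suc i, m) = (if m = Suc i then 1 else 0) - (if m = i then fps_X else 0)"
    if "m < k" "Suc i < k" for m i
    using that by (simp add: B_def companion_mat_def)
  \<comment> \<open>The first column of \<open>L\<close> is \<open>1, X, ..., X ^ (k - 1)\<close>,
    so this single entry is already the whole polynomial.\<close>
  have entry0: "(B * L) $$ (0, 0) = 1 + (\<Sum>m<k. fps_const (a (Suc m)) * fps_X ^ Suc m)"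
  proof -
    have "(B * L) $$ (0, 0) = (\<Sum>m<k. B $$ (0, m) * L $$ (m, 0))"
      using assms B L by (simp add: scalar_prod_def lessThan_atLeast0)
    also have "\<dots> = (\<Sum>m<k. (if m = 0 then 1 else 0) + fps_const (a (Suc m)) * fps_X ^ Suc m)"
      using assms by (intro sum.cong) (auto simp: B0 L_def algebra_simps)
    finally show ?thesis using assms by (simp add: sum.distrib)
  qed
  \<comment> \<open>Below the diagonal, row \<open>i + 1\<close> of \<open>L\<close> is
    \<open>X\<close> times row \<open>i\<close>, so these entries cancel; the diagonal ones stay
    1.\<close>
  have entryS: "(B * L) $$ (Suc i, j) = L $$ (Suc i, j) - fps_X * L $$ (i, j)"
    if "Suc i < k" "j < k" for i j
  proof -
    have "(B * L) $$ (Suc i, j) = (\<Sum>m<k. B $$ (Suc i, m) * L $$ (m, j))"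
      using that B L by (simp add: scalar_prod_def lessThan_atLeast0)
    also have "\<dots> = (\<Sum>m<k. (if m = Suc i then L $$ (Suc i, j) else 0)
        - (if m = i then fps_X * L $$ (i, j) else 0))"
      using that by (intro sum.cong) (auto simp: BS)
    finally show ?thesis using that by (simp add: sum_subtractf)
  qed
  have diagS: "(B * L) $$ (i, i) = 1" if "0 < i" "i < k" for i
    using that entryS[of "i - 1" i] by (simp add: L_def)
  have "upper_triangular (B * L)"
  proof (rule upper_triangularI)
    fix i j assume "j < i" "i < dim_row (B * L)"
    then have ij: "j < i" "i < k" using BL by auto
    then obtain i' where i': "i = Suc i'" "j \<le> i'" by (cases i) auto
    show "(B * L) $$ (i, j) = 0"
      using ij i' entryS[of i' j] by (simp add: L_def Suc_diff_le)
  qed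
  then have "det (B * L) = (\<Prod>i = 0..<k. (B * L) $$ (i, i))"
    using B BL by (simp add: det_upper_triangular[OF _ BL] prod_list_diag_prod)
  also have "\<dots> = (B * L) $$ (0, 0) * (\<Prod>i\<in>{0..<k} - {0}. (B * L) $$ (i, i))"
    using assms by (intro prod.remove) auto
  also have "(\<Prod>i\<in>{0..<k} - {0}. (B * L) $$ (i, i)) = 1"
    by (intro prod.neutral) (auto simp: diagS simp del: index_mult_mat)
  finally have "det (B * L) = (B * L) $$ (0, 0)" by simp
  moreover have "det L = 1"
    by (subst det_lower_triangular[OF _ L]) (auto simp: L_def prod_list_diag_prod)
  ultimately have "det B = (B * L) $$ (0, 0)"
    by (simp add: det_mult[OF B L] del: index_mult_mat)
  then show ?thesis
    unfolding entry0 by (simp add: rev_char_fps_def B_def companion_mat_def)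
qed

lemma rev_char_fps_companion_mat_nth:
  assumes "0 < r" "r \<le> k"
  shows "fps_nth (rev_char_fps (companion_mat k a)) r = a r"
proof -
  have "fps_nth (rev_char_fps (companion_mat k a)) r
      = (\<Sum>m<k. a (Suc m) * (if r = Suc m then 1 else 0))"
    using assms by (simp add: rev_char_fps_companion_mat fps_sum_nth fps_X_power_nth del: power_Suc)
  also have "\<dots> = (\<Sum>m<k. if m = r - 1 then a (Suc m) else 0)"
    using assms by (intro sum.cong) auto
  finally show ?thesis using assms by simp
qed

section \<open>Elementary symmetric polynomials and diagonal matrices\<close>

lemma elem_sym_reindex:
  assumes "bij_betw h I J"
  shows "elem_sym r J x = elem_sym r I (\<lambda>i. x (h i))"
proof -
  have inj: "inj_on h I" and J: "J = h ` I" using assms by (auto simp: bij_betw_def)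
  have "{S. S \<subseteq> J \<and> card S = r} = (`) h ` {S. S \<subseteq> I \<and> card S = r}"
    using inj by (auto simp: J subset_image_iff card_image inj_on_subset)
  moreover have "inj_on ((`) h) {S. S \<subseteq> I \<and> card S = r}"
    by (rule inj_on_subset[OF inj_on_image_Pow[OF inj]]) auto
  moreover have "(\<Prod>i\<in>h ` S. x i) = (\<Prod>i\<in>S. x (h i))" if "S \<subseteq> I" for S
    using prod.reindex[OF inj_on_subset[OF inj that]] by simp
  ultimately show ?thesis
    by (simp add: elem_sym_def sum.reindex)
qed

lemma elem_sym_uminus: "elem_sym r I (\<lambda>i. - x i) = (-1) ^ r * elem_sym r I x"
  by (simp add: elem_sym_def prod_uminus sum_distrib_left)

text \<open>Expand the product: a subset \<open>S\<close> of \<open>I\<close> records the factors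
  contributing \<open>x i X\<close> instead of 1, which gives a term of degree
  \<open>card S\<close>.\<close>

lemma fps_nth_prod_one_plus:
  fixes x :: "'i \<Rightarrow> 'a::comm_ring_1"
  assumes "finite I"
  shows "fps_nth (\<Prod>i\<in>I. 1 + fps_const (x i) * fps_X) r = elem_sym r I x"
proof -
  have c: "(\<Prod>i\<in>S. fps_const (x i)) = fps_const (\<Prod>i\<in>S. x i)" for S
    by (induction S rule: infinite_finite_induct) auto
  have "(\<Prod>i\<in>I. 1 + fps_const (x i) * fps_X) = (\<Prod>i\<in>I. fps_const (x i) * fps_X + 1)"
    by (simp add: add.commute)
  also have "\<dots> = (\<Sum>S\<in>Pow I. fps_const (\<Prod>i\<in>S. x i) * fps_X ^ card S)"
    using assms by (simp add: prod_add prod.distrib c)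
  finally have "fps_nth (\<Prod>i\<in>I. 1 + fps_const (x i) * fps_X) r
      = (\<Sum>S\<in>Pow I. if card S = r then \<Prod>i\<in>S. x i else 0)"
    by (auto simp: fps_sum_nth fps_X_power_nth intro!: sum.cong)
  also have "\<dots> = elem_sym r I x"
    using assms unfolding elem_sym_def
    by (subst sum.inter_filter[symmetric]) (auto intro!: sum.cong)
  finally show ?thesis .
qed

lemma rev_char_fps_mat_diag_nth:
  "fps_nth (rev_char_fps (mat_diag n d)) r = elem_sym r {..<n} (\<lambda>i. - d i)"
proof -
  let ?B = "1\<^sub>m n - fps_X \<cdot>\<^sub>m map_mat fps_const (mat_diag n d)"
  have B: "?B \<in> carrier_mat n n"
    by (intro minus_carrier_mat) (simp add: mat_diag_def)
  have "rev_char_fps (mat_diag n d) = det ?B"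
    by (simp add: rev_char_fps_def mat_diag_def)
  also have "\<dots> = (\<Prod>i = 0..<n. ?B $$ (i, i))"
    using B by (subst det_upper_triangular[OF _ B]) (auto simp: prod_list_diag_prod mat_diag_def)
  also have "\<dots> = (\<Prod>i<n. 1 + fps_const (- d i) * fps_X)"
    unfolding lessThan_atLeast0
    by (intro prod.cong) (auto simp: mat_diag_def mult.commute simp flip: fps_const_neg)
  finally show ?thesis
    by (simp add: fps_nth_prod_one_plus del: fps_const_neg)
qed

lemma tensor_mat_mat_diag:
  "tensor_mat (mat_diag n c) (mat_diag n d) = mat_diag (n * n) (\<lambda>i. c (i div n) * d (i mod n))"
proof (rule eq_matI)
  fix i j
  assume "i < dim_row (mat_diag (n * n) (\<lambda>i. c (i div n) * d (i mod n)))"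
    "j < dim_col (mat_diag (n * n) (\<lambda>i. c (i div n) * d (i mod n)))"
  then have ij: "i < n * n" "j < n * n" by (auto simp: mat_diag_def)
  then have n: "n > 0" by (cases n) auto
  have "i div n < n" "i mod n < n" "j div n < n" "j mod n < n"
    using ij n by (auto simp: less_mult_imp_div_less)
  moreover have "i div n = j div n \<and> i mod n = j mod n \<longleftrightarrow> i = j"
    by (metis div_mult_mod_eq)
  ultimately show "tensor_mat (mat_diag n c) (mat_diag n d) $$ (i, j)
      = mat_diag (n * n) (\<lambda>i. c (i div n) * d (i mod n)) $$ (i, j)"
    using ij by (auto simp: tensor_mat_def mat_diag_def)
qed (auto simp: tensor_mat_def mat_diag_def)

text \<open>Applied coefficientwise, a ring homomorphism extends to power series, fixes
  \<open>X\<close> and commutes with determinants. This is used to specialise generic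
  matrices.\<close>

lemma (in comm_ring_hom) rev_char_fps_hom:
  assumes M: "M \<in> carrier_mat n n"
  shows "fps_nth (rev_char_fps (map_mat hom M)) k = hom (fps_nth (rev_char_fps M) k)"
proof -
  let ?h = "\<lambda>F. Abs_fps (\<lambda>k. hom (fps_nth F k))"
  interpret h: comm_ring_hom ?h
    by unfold_locales (auto simp: fps_eq_iff hom_distribs fps_mult_nth)
  have "map_mat ?h (1\<^sub>m n - fps_X \<cdot>\<^sub>m map_mat fps_const M)
      = 1\<^sub>m n - fps_X \<cdot>\<^sub>m map_mat fps_const (map_mat hom M)"
    using M by (intro eq_matI) (auto simp: fps_eq_iff hom_distribs)
  then have "rev_char_fps (map_mat hom M) = ?h (rev_char_fps M)"
    using M by (simp add: rev_char_fps_def flip: h.hom_det)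
  then show ?thesis by simp
qed

section \<open>Evaluation of integer polynomials\<close>

definition eval_monomial :: "('v \<Rightarrow> 'a::comm_ring_1) \<Rightarrow> ('v \<Rightarrow>\<^sub>0 nat) \<Rightarrow> 'a" where
  "eval_monomial f m = (\<Prod>v\<in>Poly_Mapping.keys m. f v ^ Poly_Mapping.lookup m v)"

lemma eval_monomial_superset:
  assumes "finite V" "Poly_Mapping.keys m \<subseteq> V"
  shows "eval_monomial f m = (\<Prod>v\<in>V. f v ^ Poly_Mapping.lookup m v)"
  unfolding eval_monomial_def using assms
  by (intro prod.mono_neutral_left) (auto simp: in_keys_iff)

lemma eval_monomial_add: "eval_monomial f (m + m') = eval_monomial f m * eval_monomial f m'"
proof -
  let ?V = "Poly_Mapping.keys m \<union> Poly_Mapping.keys m'"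
  have "eval_monomial f (m + m') = (\<Prod>v\<in>?V. f v ^ Poly_Mapping.lookup (m + m') v)"
    by (intro eval_monomial_superset Poly_Mapping.keys_add) auto
  also have "\<dots> = eval_monomial f m * eval_monomial f m'"
    by (simp add: eval_monomial_superset[of ?V] lookup_add power_add prod.distrib)
  finally show ?thesis .
qed

lemma eval_mpoly_superset:
  assumes "finite K" "Poly_Mapping.keys p \<subseteq> K"
  shows "eval_mpoly f p = (\<Sum>m\<in>K. of_int (Poly_Mapping.lookup p m) * eval_monomial f m)"
  unfolding eval_mpoly_def eval_monomial_def using assms
  by (intro sum.mono_neutral_left) (auto simp: in_keys_iff)

lemma eval_mpoly_single: "eval_mpoly f (Poly_Mapping.single m a) = of_int a * eval_monomial f m"
  by (subst eval_mpoly_superset[of "{m}"]) auto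

lemma eval_mpoly_add: "eval_mpoly f (p + q) = eval_mpoly f p + eval_mpoly f q"
proof -
  let ?K = "Poly_Mapping.keys p \<union> Poly_Mapping.keys q"
  have "eval_mpoly f (p + q) = (\<Sum>m\<in>?K. of_int (Poly_Mapping.lookup (p + q) m) * eval_monomial f m)"
    by (intro eval_mpoly_superset Poly_Mapping.keys_add) auto
  also have "\<dots> = eval_mpoly f p + eval_mpoly f q"
    by (simp add: eval_mpoly_superset[of ?K] lookup_add distrib_right sum.distrib)
  finally show ?thesis .
qed

text \<open>Building polynomials one term at a time reduces multiplicativity of evaluation to
  products of two single terms.\<close>

lemma poly_mapping_single_induct [case_names zero add]:
  fixes p :: "'b \<Rightarrow>\<^sub>0 'c::monoid_add"
  assumes "P 0" and add: "\<And>p m a. P p \<Longrightarrow> P (Poly_Mapping.single m a + p)"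
  shows "P p"
proof (induction p rule: update_induct)
  case (update p m a)
  have "Poly_Mapping.update m a p = Poly_Mapping.single m a + p"
    using update by (intro poly_mapping_eqI) (auto simp: lookup_update lookup_add lookup_single in_keys_iff when_def)
  then show ?case using update add by simp
qed fact

lemma eval_mpoly_mult: "eval_mpoly f (p * q) = eval_mpoly f p * eval_mpoly f q"
proof (induction p rule: poly_mapping_single_induct)
  case zero
  then show ?case by (simp add: eval_mpoly_def)
next
  case (add p m a)
  have "eval_mpoly f (Poly_Mapping.single m a * q) = eval_mpoly f (Poly_Mapping.single m a) * eval_mpoly f q"
  proof (induction q rule: poly_mapping_single_induct)
    case zero
    then show ?case by (simp add: eval_mpoly_def)
  next
    case (add q n b)
    then show ?case
      by (simp add: distrib_left eval_mpoly_add mult_single eval_mpoly_single eval_monomial_add mult_ac)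
  qed
  with add show ?case by (simp add: distrib_right eval_mpoly_add)
qed

lemma comm_ring_hom_eval_mpoly: "comm_ring_hom (eval_mpoly f)"
proof
  have "eval_mpoly f 1 = of_int 1 * eval_monomial f 0"
    by (simp add: eval_mpoly_single flip: single_one)
  then show "eval_mpoly f 1 = 1" by (simp add: eval_monomial_def)
  show "eval_mpoly f 0 = 0" by (simp add: eval_mpoly_def)
qed (simp_all add: eval_mpoly_add eval_mpoly_mult)

lemma eval_mpoly_mvar [simp]: "eval_mpoly f (mvar v) = f v"
  by (simp add: mvar_def eval_mpoly_single eval_monomial_def)

lemma (in comm_ring_hom) hom_eval_mpoly: "hom (eval_mpoly f p) = eval_mpoly (\<lambda>v. hom (f v)) p"
  by (simp add: eval_mpoly_def hom_distribs)

lemma (in comm_ring_hom) hom_elem_sym: "hom (elem_sym r I x) = elem_sym r I (\<lambda>i. hom (x i))"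
  by (simp add: elem_sym_def hom_distribs)

lemma eval_mpoly_cong:
  assumes "\<And>v. v \<in> mvars p \<Longrightarrow> f v = g v"
  shows "eval_mpoly f p = eval_mpoly g p"
proof -
  have "f v = g v" if "m \<in> Poly_Mapping.keys p" "v \<in> Poly_Mapping.keys m" for m v
    using assms that by (auto simp: mvars_def)
  then show ?thesis by (simp add: eval_mpoly_def cong: sum.cong prod.cong)
qed

section \<open>Variables occurring in integer polynomials\<close>

lemma mvars_add: "mvars (p + q) \<subseteq> mvars p \<union> mvars q"
  using Poly_Mapping.keys_add[of p q] by (auto simp: mvars_def)

lemma mvars_uminus [simp]: "mvars (- p) = mvars p"
  by (simp add: mvars_def)

lemma mvars_mult: "mvars (p * q) \<subseteq> mvars p \<union> mvars q"
proof
  fix v assume "v \<in> mvars (p * q)"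
  then obtain m where m: "m \<in> Poly_Mapping.keys (p * q)" "v \<in> Poly_Mapping.keys m"
    by (auto simp: mvars_def)
  then obtain a b where "m = a + b" "a \<in> Poly_Mapping.keys p" "b \<in> Poly_Mapping.keys q"
    using keys_mult[of p q] by blast
  then show "v \<in> mvars p \<union> mvars q"
    using m Poly_Mapping.keys_add[of a b] by (auto simp: mvars_def)
qed

lemma mvars_0 [simp]: "mvars 0 = {}" and mvars_1 [simp]: "mvars 1 = {}"
  and mvars_mvar [simp]: "mvars (mvar v) = {v}"
  by (simp_all add: mvars_def mvar_def)

text \<open>The Leibniz formula uses only ring operations on the entries.\<close>

lemma det_mem_subring:
  assumes "0 \<in> S" "1 \<in> S" "\<And>x. x \<in> S \<Longrightarrow> - x \<in> S"
    and "\<And>x y. x \<in> S \<Longrightarrow> y \<in> S \<Longrightarrow> x + y \<in> S" "\<And>x y. x \<in> S \<Longrightarrow> y \<in> S \<Longrightarrow> x * y \<in> S"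
    and A: "A \<in> carrier_mat n n" "\<And>i j. i < n \<Longrightarrow> j < n \<Longrightarrow> A $$ (i, j) \<in> S"
  shows "det A \<in> S"
proof -
  have sum: "sum f I \<in> S" if "\<And>i. i \<in> I \<Longrightarrow> f i \<in> S" for f :: "(nat \<Rightarrow> nat) \<Rightarrow> 'a" and I
    using that assms by (induction I rule: infinite_finite_induct) auto
  have prod: "prod f I \<in> S" if "\<And>i. i \<in> I \<Longrightarrow> f i \<in> S" for f :: "nat \<Rightarrow> 'a" and I
    using that assms by (induction I rule: infinite_finite_induct) auto
  have "(\<Prod>i = 0..<n. A $$ (i, p i)) \<in> S" if "p permutes {0..<n}" for p
    using A permutes_in_image[OF that] by (intro prod) auto
  then show ?thesis
    unfolding det_def'[OF A(1)] using assms(2,3,5)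
    by (intro sum) (auto simp: sign_def)
qed

text \<open>Power series whose coefficients all involve only variables from \<open>V\<close> form a
  subring, and it contains the entries of \<open>I - XM\<close>.\<close>

lemma mvars_rev_char_fps_nth:
  fixes M :: "'v int_mpoly mat"
  assumes M: "M \<in> carrier_mat n n" and V: "\<And>i j. i < n \<Longrightarrow> j < n \<Longrightarrow> mvars (M $$ (i, j)) \<subseteq> V"
  shows "mvars (fps_nth (rev_char_fps M) k) \<subseteq> V"
proof -
  define S where "S = {F :: 'v int_mpoly fps. \<forall>k. mvars (fps_nth F k) \<subseteq> V}"
  have sum: "mvars (sum f I) \<subseteq> V" if "\<And>i. i \<in> I \<Longrightarrow> mvars (f i) \<subseteq> V"
    for f :: "nat \<Rightarrow> 'v int_mpoly" and I
    using that
    by (induction I rule: infinite_finite_induct) (auto intro!: order_trans[OF mvars_add])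
  have mem: "0 \<in> S" "1 \<in> S" "\<And>x. x \<in> S \<Longrightarrow> - x \<in> S" "\<And>x y. x \<in> S \<Longrightarrow> y \<in> S \<Longrightarrow> x + y \<in> S"
    "fps_X \<in> S"
    by (auto simp: S_def fps_X_def intro!: order_trans[OF mvars_add])
  moreover have mult: "x * y \<in> S" if "x \<in> S" "y \<in> S" for x y
    using that unfolding S_def mem_Collect_eq fps_mult_nth
    by (intro allI sum order_trans[OF mvars_mult] Un_least) auto
  moreover have "fps_const p \<in> S" if "mvars p \<subseteq> V" for p
    using that by (auto simp: S_def)
  ultimately have "det (1\<^sub>m n - fps_X \<cdot>\<^sub>m map_mat fps_const M) \<in> S"
    using M V
    by (intro det_mem_subring[of S _ n] minus_carrier_mat)
      (auto simp: diff_conv_add_uminus simp del: add_uminus_conv_diff)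
  then show ?thesis using M by (simp add: S_def rev_char_fps_def)
qed

section \<open>Values of polynomials at complex points\<close>

text \<open>Reduction modulo \<open>B\<close> isolates the lowest digit; cancelling it and dividing
  by \<open>B\<close> leaves a shorter expansion.\<close>

lemma digits_unique:
  fixes a b :: "nat \<Rightarrow> nat"
  assumes "\<And>i. i < n \<Longrightarrow> a i < B" "\<And>i. i < n \<Longrightarrow> b i < B"
    and "(\<Sum>i<n. a i * B ^ i) = (\<Sum>i<n. b i * B ^ i)" and "i < n"
  shows "a i = b i"
  using assms
proof (induction n arbitrary: a b i)
  case (Suc n)
  have shift: "(\<Sum>i<Suc n. c i * B ^ i) = c 0 + B * (\<Sum>i<n. c (Suc i) * B ^ i)" for c :: "nat \<Rightarrow> nat"
    by (simp add: sum.lessThan_Suc_shift sum_distrib_left mult_ac del: sum.lessThan_Suc)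
  let ?A = "\<Sum>i<n. a (Suc i) * B ^ i" and ?B = "\<Sum>i<n. b (Suc i) * B ^ i"
  have eq: "a 0 + B * ?A = b 0 + B * ?B" using Suc.prems(3) unfolding shift .
  have lt: "a 0 < B" "b 0 < B" using Suc.prems by auto
  have 0: "a 0 = b 0" using arg_cong[OF eq, of "\<lambda>x. x mod B"] lt by simp
  have AB: "?A = ?B" using eq 0 lt by simp
  have "a (Suc i) = b (Suc i)" if "i < n" for i
    by (rule Suc.IH[of "\<lambda>i. a (Suc i)" "\<lambda>i. b (Suc i)", OF _ _ AB that])
      (use Suc.prems(1,2) in auto)
  with 0 show ?case using Suc.prems by (cases i) auto
qed simp

text \<open>Kronecker substitution: sending the \<open>i\<close>-th variable to \<open>z ^ (B ^ i)\<close> with \<open>B\<close> larger than all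
  exponents keeps distinct monomials distinct.\<close>

lemma eval_mpoly_nonzero:
  fixes p :: "'v int_mpoly"
  assumes "p \<noteq> 0"
  shows "\<exists>c :: 'v \<Rightarrow> complex. eval_mpoly c p \<noteq> 0"
proof -
  let ?K = "Poly_Mapping.keys p"
  have "finite (mvars p)" by (simp add: mvars_def)
  then obtain h where h: "bij_betw h {0..<card (mvars p)} (mvars p)"
    using ex_bij_betw_nat_finite by blast
  define n where "n = card (mvars p)"
  have h: "bij_betw h {..<n} (mvars p)" using h by (simp add: n_def lessThan_atLeast0)
  \<comment> \<open>One more than the sum of all exponents strictly exceeds each of them.\<close>
  define B where "B = Suc (\<Sum>m\<in>?K. \<Sum>v\<in>mvars p. Poly_Mapping.lookup m v)"
  have B: "Poly_Mapping.lookup m v < B" if "m \<in> ?K" "v \<in> mvars p" for m v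
  proof -
    have "Poly_Mapping.lookup m v \<le> (\<Sum>v\<in>mvars p. Poly_Mapping.lookup m v)"
      using that \<open>finite (mvars p)\<close> by (intro member_le_sum) auto
    also have "\<dots> \<le> (\<Sum>m\<in>?K. \<Sum>v\<in>mvars p. Poly_Mapping.lookup m v)"
      using that by (intro member_le_sum) auto
    finally show ?thesis by (simp add: B_def)
  qed
  \<comment> \<open>The substitution turns the monomial \<open>m\<close> into
    \<open>z ^ w m\<close>; the exponents of \<open>m\<close> are the base \<open>B\<close> digits
    of \<open>w m\<close>.\<close>
  define w where "w m = (\<Sum>i<n. Poly_Mapping.lookup m (h i) * B ^ i)" for m
  have inj: "m = m'" if m: "m \<in> ?K" "m' \<in> ?K" and "w m = w m'" for m m'
  proof (rule poly_mapping_eqI)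
    fix v
    show "Poly_Mapping.lookup m v = Poly_Mapping.lookup m' v"
    proof (cases "v \<in> mvars p")
      case True
      then obtain i where i: "i < n" "v = h i" using h by (auto simp: bij_betw_def)
      have "h j \<in> mvars p" if "j < n" for j using h that by (auto simp: bij_betw_def)
      then show ?thesis
        using digits_unique[of n "\<lambda>i. Poly_Mapping.lookup m (h i)" B "\<lambda>i. Poly_Mapping.lookup m' (h i)" i]
          B m \<open>w m = w m'\<close> i by (simp add: w_def)
    next
      case False
      then have "v \<notin> Poly_Mapping.keys m" "v \<notin> Poly_Mapping.keys m'"
        using m by (auto simp: mvars_def)
      then show ?thesis by (simp add: in_keys_iff)
    qed
  qed
  define P :: "complex poly" where "P = (\<Sum>m\<in>?K. monom (of_int (Poly_Mapping.lookup p m)) (w m))"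
  define c :: "complex \<Rightarrow> 'v \<Rightarrow> complex" where "c z v = z ^ (B ^ (inv_into {..<n} h v))" for z v
  have "eval_mpoly (c z) p = poly P z" for z
  proof -
    have "eval_monomial (c z) m = z ^ w m" if "m \<in> ?K" for m
    proof -
      have "eval_monomial (c z) m = (\<Prod>v\<in>mvars p. c z v ^ Poly_Mapping.lookup m v)"
        using that \<open>finite (mvars p)\<close> by (intro eval_monomial_superset) (auto simp: mvars_def)
      also have "\<dots> = (\<Prod>i<n. c z (h i) ^ Poly_Mapping.lookup m (h i))"
        by (rule prod.reindex_bij_betw[OF h, symmetric])
      also have "\<dots> = (\<Prod>i<n. z ^ (Poly_Mapping.lookup m (h i) * B ^ i))"
        using h by (intro prod.cong) (auto simp: c_def bij_betw_def mult.commute simp flip: power_mult)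
      finally show ?thesis by (simp add: w_def power_sum)
    qed
    then show ?thesis
      by (simp add: P_def poly_sum poly_monom eval_mpoly_superset[of ?K])
  qed
  moreover have "P \<noteq> 0"
  proof -
    obtain m where m: "m \<in> ?K" using assms by (metis all_not_in_conv keys_eq_empty)
    \<comment> \<open>By injectivity of \<open>w\<close> no two terms of \<open>P\<close>
      merge.\<close>
    have "coeff P (w m) = (\<Sum>m'\<in>?K. if m' = m then of_int (Poly_Mapping.lookup p m') else 0)"
      unfolding P_def coeff_sum using inj m by (intro sum.cong) auto
    also have "\<dots> \<noteq> 0" using m by (simp add: in_keys_iff)
    finally show ?thesis by auto
  qed
  then obtain z where "poly P z \<noteq> 0" using poly_all_0_iff_0 by blast
  ultimately show ?thesis by metis
qed

text \<open>The monic polynomial of degree \<open>k\<close> with lower coefficients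
  \<open>c r\<close> splits over the complex numbers; by Vieta, its negated roots have the
  prescribed elementary symmetric values.\<close>

lemma elem_sym_surj:
  fixes c :: "nat \<Rightarrow> complex"
  shows "\<exists>x. \<forall>r\<in>{1..k}. elem_sym r {1..k} x = c r"
proof -
  define p where "p = monom 1 k + (\<Sum>r\<in>{1..k}. monom (c r) (k - r))"
  have "degree (\<Sum>r\<in>{1..k}. monom (c r) (k - r)) < k" if "k > 0"
    using that by (intro degree_sum_less) (auto intro: le_less_trans[OF degree_monom_le])
  then have deg: "degree p = k" "lead_coeff p = 1"
    by (cases "k = 0"; auto simp: p_def degree_add_eq_left degree_monom_eq coeff_eq_0)+
  have "p \<noteq> 0" using deg by auto
  then obtain A where A: "size A = k" "p = (\<Prod>x\<in>#A. [:- x, 1:])"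
    using alg_closed_imp_factorization[of p] deg by auto
  obtain xs where xs: "mset xs = A" using ex_mset by blast
  \<comment> \<open>The list of roots is indexed from 0, the family \<open>y\<close> from 1.\<close>
  define y where "y i = - xs ! (i - 1)" for i
  have "p = (\<Prod>x\<leftarrow>xs. [:- x, 1:])"
    unfolding A(2) xs[symmetric] by (simp flip: prod_mset_prod_list)
  also have "\<dots> = (\<Prod>i<k. [:- xs ! i, 1:])"
    using xs A(1) by (auto simp: prod.list_conv_set_nth lessThan_atLeast0)
  also have "\<dots> = (\<Prod>i\<in>{1..k}. [:y i, 1:])"
    by (rule prod.reindex_bij_witness[of _ "\<lambda>i. i - 1" Suc]) (auto simp: y_def)
  also have "\<dots> = (\<Prod>i\<in>{1..k}. [:y i:] + monom 1 1)"
    by (simp add: monom_altdef)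
  also have "\<dots> = (\<Sum>S\<in>Pow {1..k}. monom (\<Prod>i\<in>S. y i) (k - card S))"
  proof -
    have c: "(\<Prod>i\<in>S. [:y i:]) = [:\<Prod>i\<in>S. y i:]" for S
      by (induction S rule: infinite_finite_induct) (auto simp: one_pCons)
    show ?thesis
      by (subst prod_add)
        (auto intro!: sum.cong simp: c card_Diff_subset finite_subset monom_power smult_monom)
  qed
  finally have p: "p = (\<Sum>S\<in>Pow {1..k}. monom (\<Prod>i\<in>S. y i) (k - card S))" .
  have "elem_sym r {1..k} y = c r" if r: "r \<in> {1..k}" for r
  proof -
    have card: "k - card S = k - r \<longleftrightarrow> card S = r" if "S \<subseteq> {1..k}" for S
      using card_mono[OF _ that] r by auto
    have "coeff p (k - r) = (\<Sum>S\<in>Pow {1..k}. if card S = r then \<Prod>i\<in>S. y i else 0)"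
      unfolding p coeff_sum by (intro sum.cong) (simp_all add: card)
    also have "\<dots> = elem_sym r {1..k} y"
      unfolding elem_sym_def
      by (subst sum.inter_filter[symmetric]) (auto intro!: sum.cong)
    also have "coeff p (k - r) = (\<Sum>r'\<in>{1..k}. if r' = r then c r' else 0)"
    proof -
      have "k - r' = k - r \<longleftrightarrow> r' = r" if "r' \<in> {1..k}" for r'
        using r that by auto
      then show ?thesis
        using r by (auto simp: p_def coeff_sum intro!: sum.cong)
    qed
    also have "\<dots> = c r" using r by simp
    finally show ?thesis by simp
  qed
  then show ?thesis by blast
qed

section \<open>The polynomials of the ene product\<close>

text \<open>A nonzero difference is nonzero at some complex point \<open>c\<close>. Realising the
  coordinates of \<open>c\<close> as elementary symmetric values of some \<open>x\<close> and
  \<open>y\<close> contradicts the identity after specialisation to \<open>x\<close> and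
  \<open>y\<close>.\<close>

lemma ene_poly_unique:
  fixes k :: nat and Q Q' :: "(nat + nat) int_mpoly"
  defines "E \<equiv> case_sum (\<lambda>r. elem_sym r {1..k} (\<lambda>i. mvar (Inl i)))
                        (\<lambda>r. elem_sym r {1..k} (\<lambda>j. mvar (Inr j))) :: nat + nat \<Rightarrow> (nat + nat) int_mpoly"
  assumes Q: "mvars Q \<subseteq> Inl ` {1..k} \<union> Inr ` {1..k}"
    and Q': "mvars Q' \<subseteq> Inl ` {1..k} \<union> Inr ` {1..k}"
    and eq: "eval_mpoly E Q = eval_mpoly E Q'"
  shows "Q = Q'"
proof (rule ccontr)
  assume "Q \<noteq> Q'"
  then obtain c :: "nat + nat \<Rightarrow> complex" where c: "eval_mpoly c (Q + - Q') \<noteq> 0"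
    using eval_mpoly_nonzero[of "Q + - Q'"] by auto
  obtain x y where xy: "\<forall>r\<in>{1..k}. elem_sym r {1..k} x = c (Inl r)"
      "\<forall>r\<in>{1..k}. elem_sym r {1..k} y = c (Inr r)"
    using elem_sym_surj[of k "\<lambda>r. c (Inl r)"] elem_sym_surj[of k "\<lambda>r. c (Inr r)"] by auto
  interpret E: comm_ring_hom "eval_mpoly E" by (rule comm_ring_hom_eval_mpoly)
  interpret \<psi>: comm_ring_hom "eval_mpoly (case_sum x y)" by (rule comm_ring_hom_eval_mpoly)
  have "mvars (Q + - Q') \<subseteq> Inl ` {1..k} \<union> Inr ` {1..k}"
    using mvars_add[of Q "- Q'"] Q Q' by auto
  \<comment> \<open>On the variables of \<open>Q - Q'\<close>, the point \<open>c\<close> is the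
    specialisation of \<open>E\<close>, so evaluation at \<open>c\<close> factors through
    \<open>E\<close>.\<close>
  then have "eval_mpoly c (Q + - Q') = eval_mpoly (\<lambda>v. eval_mpoly (case_sum x y) (E v)) (Q + - Q')"
    using xy by (intro eval_mpoly_cong) (auto simp: E_def \<psi>.hom_elem_sym)
  also have "\<dots> = eval_mpoly (case_sum x y) (eval_mpoly E (Q + - Q'))"
    by (rule \<psi>.hom_eval_mpoly[symmetric])
  also have "eval_mpoly E (Q + - Q') = 0"
    using eq by (simp add: E.hom_add E.hom_uminus del: add_uminus_conv_diff)
  finally show False using c by simp
qed

text \<open>The factor \<open>(-1) ^ k\<close> compensates for the coefficient of \<open>X ^ k\<close> in
  \<open>\<Prod>(1 - x\<^sub>i y\<^sub>j X)\<close> being \<open>(-1) ^ k\<close> times an elementary symmetric polynomial.\<close>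

definition ene_poly_witness :: "nat \<Rightarrow> (nat + nat) int_mpoly" where
  "ene_poly_witness k = (-1) ^ k * fps_nth (rev_char_fps (tensor_mat
     (companion_mat k (\<lambda>r. mvar (Inl r))) (companion_mat k (\<lambda>r. mvar (Inr r))))) k"

text \<open>Column \<open>j < k\<close> of a generic companion matrix involves only the variable of
  index \<open>j + 1\<close>, which lies in \<open>{1..k}\<close>.\<close>

lemma mvars_ene_poly_witness: "mvars (ene_poly_witness k) \<subseteq> Inl ` {1..k} \<union> Inr ` {1..k}"
proof -
  let ?V = "Inl ` {1..k} \<union> Inr ` {1..k}"
  let ?C = "tensor_mat (companion_mat k (\<lambda>r. mvar (Inl r) :: (nat + nat) int_mpoly))
    (companion_mat k (\<lambda>r. mvar (Inr r)))"
  have "mvars (?C $$ (i, j)) \<subseteq> ?V" if ij: "i < k * k" "j < k * k" for i j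
  proof -
    have "k > 0" using ij by (cases k) auto
    then have lt: "i div k < k" "i mod k < k" "j div k < k" "j mod k < k"
      using ij by (auto simp: less_mult_imp_div_less)
    have "mvars (companion_mat k (\<lambda>r. mvar (f r)) $$ (a, b)) \<subseteq> f ` {1..k}"
      if "a < k" "b < k" for a b and f :: "nat \<Rightarrow> nat + nat"
      using that by (auto simp: companion_mat_def)
    then have "mvars (companion_mat k (\<lambda>r. mvar (Inl r) :: (nat + nat) int_mpoly) $$ (i div k, j div k)
      * companion_mat k (\<lambda>r. mvar (Inr r)) $$ (i mod k, j mod k)) \<subseteq> ?V"
      using lt by (intro order_trans[OF mvars_mult] Un_mono)
    then show ?thesis
      using ij by (simp add: tensor_mat_def companion_mat_def)
  qed
  then have "mvars (fps_nth (rev_char_fps ?C) k) \<subseteq> ?V"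
    by (intro mvars_rev_char_fps_nth[of _ "k * k"] tensor_mat_carrier) auto
  then show ?thesis
    unfolding ene_poly_witness_def by (cases "even k") auto
qed

lemma (in comm_ring_hom) companion_mat_hom:
  "map_mat hom (companion_mat k a) = companion_mat k (\<lambda>r. hom (a r))"
  by (intro eq_matI) (auto simp: companion_mat_def hom_uminus)

lemma (in comm_ring_hom) tensor_mat_hom:
  assumes "M \<in> carrier_mat n n" "N \<in> carrier_mat n n"
  shows "map_mat hom (tensor_mat M N) = tensor_mat (map_mat hom M) (map_mat hom N)"
proof (rule eq_matI)
  fix i j assume "i < dim_row (tensor_mat (map_mat hom M) (map_mat hom N))"
    "j < dim_col (tensor_mat (map_mat hom M) (map_mat hom N))"
  then have ij: "i < n * n" "j < n * n" using assms by (auto simp: tensor_mat_def)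
  then have "n > 0" by (cases n) auto
  then have "i div n < n" "i mod n < n" "j div n < n" "j mod n < n"
    using ij by (auto simp: less_mult_imp_div_less)
  then show "map_mat hom (tensor_mat M N) $$ (i, j) = tensor_mat (map_mat hom M) (map_mat hom N) $$ (i, j)"
    using assms ij by (simp add: tensor_mat_def hom_mult)
qed (simp_all add: tensor_mat_def)

text \<open>Evaluation is a ring homomorphism that sends the generic companion matrices to those of
  \<open>a\<close> and \<open>b\<close>.\<close>

lemma eval_ene_poly_witness:
  "eval_mpoly (case_sum a b) (ene_poly_witness k)
    = (-1) ^ k * fps_nth (rev_char_fps (tensor_mat (companion_mat k a) (companion_mat k b))) k"
proof -
  interpret comm_ring_hom "eval_mpoly (case_sum a b)" by (rule comm_ring_hom_eval_mpoly)
  let ?C = "\<lambda>f. companion_mat k (\<lambda>r. mvar (f r))"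
  have "rev_char_fps (tensor_mat (companion_mat k a) (companion_mat k b))
      = rev_char_fps (map_mat (eval_mpoly (case_sum a b)) (tensor_mat (?C Inl) (?C Inr)))"
    by (simp add: tensor_mat_hom[of _ k] companion_mat_hom)
  then show ?thesis
    unfolding ene_poly_witness_def
    by (simp add: rev_char_fps_hom[OF tensor_mat_carrier, of _ k] hom_mult hom_power hom_uminus)
qed

text \<open>Integer multiples act coefficientwise. This permits the trace comparison over the
  polynomial ring, where integers are not invertible.\<close>

lemma int_mpoly_torsion_free:
  fixes p :: "'v int_mpoly"
  assumes "of_nat (Suc i) * p = 0"
  shows "p = 0"
proof -
  have mult: "Poly_Mapping.lookup (of_nat n * p) m = int n * Poly_Mapping.lookup p m" for n m
    by (induction n) (simp_all add: distrib_right lookup_add)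
  show ?thesis
    using mult[of "Suc i"] assms by (intro poly_mapping_eqI) simp
qed

text \<open>The companion matrices of the elementary symmetric values agree up to degree
  \<open>k\<close> with diagonal matrices of entries \<open>-x_i\<close> and \<open>-y_j\<close>,
  whose tensor product is diagonal with entries \<open>x_i y_j\<close>.\<close>

lemma eval_ene_poly_witness_elem_sym:
  "eval_mpoly (case_sum (\<lambda>r. elem_sym r {1..k} (\<lambda>i. mvar (Inl i)))
                        (\<lambda>r. elem_sym r {1..k} (\<lambda>j. mvar (Inr j)))) (ene_poly_witness k)
     = elem_sym k ({1..k} \<times> {1..k}) (\<lambda>(i, j). mvar (Inl i) * mvar (Inr j) :: (nat + nat) int_mpoly)"
proof -
  let ?X = "\<lambda>i. mvar (Inl i) :: (nat + nat) int_mpoly"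
  let ?Y = "\<lambda>i. mvar (Inr i) :: (nat + nat) int_mpoly"
  let ?C = "\<lambda>X. companion_mat k (\<lambda>r. elem_sym r {1..k} X)"
  \<comment> \<open>\<open>det (I - XD) = \<Prod>(1 + X x\<^sub>i)\<close>, which is also \<open>det (I - XC)\<close>\<close>
  let ?D = "\<lambda>X. mat_diag k (\<lambda>i. - X (Suc i))"
  have bij: "bij_betw Suc {..<k} {1..k}"
    by (rule bij_betw_byWitness[of _ "\<lambda>i. i - 1"]) auto
  have C: "?C X \<in> carrier_mat k k" "?D X \<in> carrier_mat k k" for X :: "nat \<Rightarrow> (nat + nat) int_mpoly"
    by (auto simp: mat_diag_def)
  have eq: "fps_nth (rev_char_fps (?C X)) j = fps_nth (rev_char_fps (?D X)) j" if "j \<le> k"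
    for X :: "nat \<Rightarrow> (nat + nat) int_mpoly" and j
  proof (cases "j = 0")
    case True
    then show ?thesis using rev_char_fps_nth_0[OF C(1)] rev_char_fps_nth_0[OF C(2)] by metis
  next
    case False
    then show ?thesis
      using that elem_sym_reindex[OF bij, of j X]
      by (simp add: rev_char_fps_companion_mat_nth rev_char_fps_mat_diag_nth)
  qed
  \<comment> \<open>Matrix indices start at 0, variable indices at 1, so quotient and remainder are
    shifted by one.\<close>
  have pairs: "bij_betw (\<lambda>i. (Suc (i div k), Suc (i mod k))) {..<k * k} ({1..k} \<times> {1..k})"
  proof (rule bij_betw_byWitness[of _ "\<lambda>(a, b). (a - 1) * k + (b - 1)"])
    have k: "k > 0" if "i < k * k" for i using that by (cases k) auto
    then show "(\<lambda>i. (Suc (i div k), Suc (i mod k))) ` {..<k * k} \<subseteq> {1..k} \<times> {1..k}"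
      by (auto simp: Suc_le_eq less_mult_imp_div_less)
    have ex: "\<exists>a b. p = (Suc a, Suc b) \<and> a < k \<and> b < k" if "p \<in> {1..k} \<times> {1..k}" for p
    proof -
      have "p = (Suc (fst p - 1), Suc (snd p - 1)) \<and> fst p - 1 < k \<and> snd p - 1 < k"
        using that by (cases p) auto
      then show ?thesis by blast
    qed
    have lt: "a * k + b < k * k" if "a < k" "b < k" for a b
    proof -
      have "a * k + b < Suc a * k" using that by simp
      also have "\<dots> \<le> k * k" using that by (intro mult_le_mono1) simp
      finally show ?thesis .
    qed
    show "(\<lambda>(a, b). (a - 1) * k + (b - 1)) ` ({1..k} \<times> {1..k}) \<subseteq> {..<k * k}"
    proof (rule image_subsetI)
      fix p :: "nat \<times> nat" assume "p \<in> {1..k} \<times> {1..k}"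
      then obtain a b where "p = (Suc a, Suc b)" "a < k" "b < k" using ex by blast
      then show "(case p of (a, b) \<Rightarrow> (a - 1) * k + (b - 1)) \<in> {..<k * k}" using lt by simp
    qed
    show "\<forall>p\<in>{1..k} \<times> {1..k}. (\<lambda>i. (Suc (i div k), Suc (i mod k)))
        ((\<lambda>(a, b). (a - 1) * k + (b - 1)) p) = p"
    proof
      fix p :: "nat \<times> nat" assume "p \<in> {1..k} \<times> {1..k}"
      then obtain a b where "p = (Suc a, Suc b)" "a < k" "b < k" using ex by blast
      then show "(\<lambda>i. (Suc (i div k), Suc (i mod k))) ((\<lambda>(a, b). (a - 1) * k + (b - 1)) p) = p" by simp
    qed
  qed auto
  have "fps_nth (rev_char_fps (tensor_mat (?C ?X) (?C ?Y))) k
      = fps_nth (rev_char_fps (tensor_mat (?D ?X) (?D ?Y))) k"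
    by (rule rev_char_fps_tensor_mat_nth_cong[OF int_mpoly_torsion_free C(1) C(1) C(2) C(2) eq eq])
  \<comment> \<open>The signs of the two diagonal matrices cancel; the remaining one comes from
    \<open>I - XD\<close>.\<close>
  also have "\<dots> = elem_sym k {..<k * k} (\<lambda>i. - (?X (Suc (i div k)) * ?Y (Suc (i mod k))))"
    by (simp add: tensor_mat_mat_diag rev_char_fps_mat_diag_nth)
  also have "\<dots> = (-1) ^ k * elem_sym k ({1..k} \<times> {1..k}) (\<lambda>(i, j). ?X i * ?Y j)"
    by (simp only: elem_sym_uminus elem_sym_reindex[OF pairs] prod.case)
  finally show ?thesis
    by (simp add: eval_ene_poly_witness flip: power_add mult.assoc)
qed

lemma ene_poly_eq: "ene_poly k = ene_poly_witness k"
  unfolding ene_poly_def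
proof (rule the_equality, intro conjI)
  fix Q assume "mvars Q \<subseteq> Inl ` {1..k} \<union> Inr ` {1..k} \<and>
     eval_mpoly (case_sum (\<lambda>r. elem_sym r {1..k} (\<lambda>i. mvar (Inl i)))
                          (\<lambda>r. elem_sym r {1..k} (\<lambda>j. mvar (Inr j)))) Q
       = elem_sym k ({1..k} \<times> {1..k})
           (\<lambda>(i, j). mvar (Inl i) * mvar (Inr j) :: (nat + nat) int_mpoly)"
  then show "Q = ene_poly_witness k"
    using mvars_ene_poly_witness[of k] eval_ene_poly_witness_elem_sym[of k]
    by (intro ene_poly_unique[of Q k]) auto
qed (rule mvars_ene_poly_witness eval_ene_poly_witness_elem_sym)+

section \<open>The ene product as a determinant of a tensor product\<close>

text \<open>The sign \<open>(-1) ^ k\<close> in the ene product cancels the one in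
  \<open>ene_poly_witness\<close>.\<close>

lemma ene_nth:
  "fps_nth (f \<star> g) k = (if k = 0 then 1 else fps_nth (rev_char_fps (tensor_mat
     (companion_mat k (fps_nth f)) (companion_mat k (fps_nth g)))) k)"
  by (simp add: ene_def ene_poly_eq eval_ene_poly_witness flip: power_add mult.assoc)

text \<open>The image of \<open>1 / (i + 1)\<close> is an inverse of \<open>i + 1\<close>.\<close>

lemma torsion_free_of_rat_algebra:
  fixes h :: "rat \<Rightarrow> 'a::comm_ring_1"
  assumes "comm_ring_hom h" "of_nat (Suc i) * (a :: 'a) = 0"
  shows "a = 0"
proof -
  interpret comm_ring_hom h by fact
  have "h (1 / of_nat (Suc i)) * of_nat (Suc i) = h (1 / of_nat (Suc i) * of_nat (Suc i))"
    by (simp only: hom_mult hom_of_nat)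
  also have "\<dots> = 1" by (simp del: of_nat_Suc)
  finally have "a = h (1 / of_nat (Suc i)) * (of_nat (Suc i) * a)"
    by (simp only: mult.assoc[symmetric] mult_1_left)
  then show ?thesis using assms(2) by simp
qed

theorem theorem7p1:
  fixes M N :: "'a::comm_ring_1 mat" and n :: nat
  assumes contains_rat: "\<exists>h :: rat \<Rightarrow> 'a. inj_comm_ring_hom h"
    and "n \<ge> 1"
    and "M \<in> carrier_mat n n"
    and "N \<in> carrier_mat n n"
  shows "det (1\<^sub>m n - fps_X \<cdot>\<^sub>m map_mat fps_const M) \<star> det (1\<^sub>m n - fps_X \<cdot>\<^sub>m map_mat fps_const N)
       = det (1\<^sub>m (n * n) - fps_X \<cdot>\<^sub>m map_mat fps_const (tensor_mat M N))"
proof -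
  note M = \<open>M \<in> carrier_mat n n\<close> and N = \<open>N \<in> carrier_mat n n\<close>
  have torsion_free: "a = 0" if "of_nat (Suc i) * a = 0" for i and a :: 'a
    using contains_rat that torsion_free_of_rat_algebra inj_comm_ring_hom.axioms(1) by metis
  \<comment> \<open>Whatever the size \<open>n\<close> of \<open>A\<close>, a
    \<open>k \<times> k\<close> companion matrix reproduces its series up to degree
    \<open>k\<close>.\<close>
  have eq: "fps_nth (rev_char_fps (companion_mat k (fps_nth (rev_char_fps A)))) j
      = fps_nth (rev_char_fps A) j" if "j \<le> k" and A: "A \<in> carrier_mat n n" for A :: "'a mat" and j k
  proof (cases "j = 0")
    case True
    then show ?thesis using rev_char_fps_nth_0[OF A] rev_char_fps_nth_0[OF companion_mat_carrier] by metis
  next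
    case False
    then show ?thesis using that by (simp add: rev_char_fps_companion_mat_nth)
  qed
  have "rev_char_fps M \<star> rev_char_fps N = rev_char_fps (tensor_mat M N)"
  proof (rule fps_ext)
    fix k
    show "fps_nth (rev_char_fps M \<star> rev_char_fps N) k = fps_nth (rev_char_fps (tensor_mat M N)) k"
    proof (cases "k = 0")
      case True
      then show ?thesis using rev_char_fps_nth_0[OF tensor_mat_carrier[OF M N]] by (simp add: ene_nth)
    next
      case False
      \<comment> \<open>The comparison is applied with companion matrices of size \<open>k\<close>
        against \<open>M\<close> and \<open>N\<close> of size \<open>n\<close>.\<close>
      then show ?thesis
        using rev_char_fps_tensor_mat_nth_cong[OF torsion_free companion_mat_carrier
            companion_mat_carrier M N eq[OF _ M] eq[OF _ N]]
        by (simp add: ene_nth)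
    qed
  qed
  then show ?thesis
    using M N by (simp add: rev_char_fps_def tensor_mat_def)
qed

end
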